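(* For the Grover walk started in $|0,R\rangle$ with a single absorbing boundary at $-1$, the absorbing probability $P_{\underline{-1,0,\infty}}(0,0,1)$ equals $0.6693$ to four decimal places, i.e. $|P_{\underline{-1,0,\infty}}(0,0,1)-0.6693|\le 5\cdot10^{-5}$; in particular it is larger than $2/\pi$.
   Context: The Grover walk acts on the Hilbert space $\mathcal H=\ell^2(\mathbb Z)\otimes\mathbb C^3$ with orthonormal basis $|m,c\rangle=|m\rangle\otimes|c\rangle$, $m\in\mathbb Z$, $c\in\{L,S,R\}$. The evolution operator is $U=\mathrm{Sh}\cdot(I\otimes G)$, where, in the ordered basis $(L,S,R)$, $G=\frac13\begin{pmatrix}-1&2&2\\2&-1&2\\2&2&-1\end{pmatrix}$, and the shift is $\mathrm{Sh}|m,L\rangle=|m-1,L\rangle$, $\mathrm{Sh}|m,S\rangle=|m,S\rangle$, $\mathrm{Sh}|m,R\rangle=|m+1,R\rangle$. For $n\in\mathbb Z$, $\Pi_{yes}^{n}=|n\rangle\langle n|\otimes I$ and $\Pi_{no}^{n}=I-\Pi_{yes}^{n}$. One-boundary process with boundary $-1$: start in $\psi_0=\alpha|0,L\rangle+\beta|0,S\rangle+\gamma|0,R\rangle$ (unit vector); at each step apply $U$, then measure $\{\Pi_{yes}^{-1},\Pi_{no}^{-1}\}$, stopping when the outcome is "yes". The absorbing probability is $$P_{\underline{-1,0,\infty}}(\alpha,\beta,\gamma)=\sum_{t\ge1}\big\|\Pi_{yes}^{-1}U(\Pi_{no}^{-1}U)^{t-1}\psi_0\big\|^2 .$$ *)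

theory Defs
  imports "HOL-Analysis.Analysis"
begin

datatype coin = L | S | R

lemma UNIV_coin: "UNIV = {L, S, R}"
  using coin.exhaust by auto

instance coin :: finite
  by standard (simp add: UNIV_coin)

text \<open>
  A vector of \<open>\<ell>\<^sup>2(\<int>) \<otimes> \<complex>\<^sup>3\<close> is represented by its coefficient function: \<open>\<psi> m $ c\<close> is
  the coefficient at \<open>|m,c\<rangle>\<close>. Operators are defined on all coefficient functions; the lemmas
  below show that they map the Hilbert space \<open>ell2\<close> into itself.
\<close>

type_synonym state = "int \<Rightarrow> complex ^ coin"

definition ell2 :: "state set" where
  "ell2 = {\<psi>. (\<lambda>m. (norm (\<psi> m))\<^sup>2) summable_on UNIV}"

definition ell2_norm :: "state \<Rightarrow> real" where
  "ell2_norm \<psi> = sqrt (\<Sum>\<^sub>\<infinity>m. (norm (\<psi> m))\<^sup>2)"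

definition ket :: "int \<Rightarrow> coin \<Rightarrow> state" where
  "ket m c = (\<lambda>k. if k = m then axis c 1 else 0)"

definition grover_matrix :: "complex ^ coin ^ coin" where
  "grover_matrix = (\<chi> i j. if i = j then - 1 / 3 else 2 / 3)"

definition coin_op :: "state \<Rightarrow> state" where
  "coin_op \<psi> = (\<lambda>m. grover_matrix *v \<psi> m)"

text \<open>On coefficients the shift reads off the source site; see \<open>shift_ket\<close>.\<close>

definition shift :: "state \<Rightarrow> state" where
  "shift \<psi> = (\<lambda>m. \<chi> c. case c of L \<Rightarrow> \<psi> (m + 1) $ L | S \<Rightarrow> \<psi> m $ S | R \<Rightarrow> \<psi> (m - 1) $ R)"

definition evolve :: "state \<Rightarrow> state" where
  "evolve \<psi> = shift (coin_op \<psi>)"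

definition proj_yes :: "int \<Rightarrow> state \<Rightarrow> state" where
  "proj_yes n \<psi> = (\<lambda>m. if m = n then \<psi> m else 0)"

definition proj_no :: "int \<Rightarrow> state \<Rightarrow> state" where
  "proj_no n \<psi> = (\<lambda>m. \<psi> m - proj_yes n \<psi> m)"

definition initial_state :: "complex \<Rightarrow> complex \<Rightarrow> complex \<Rightarrow> state" where
  "initial_state \<alpha> \<beta> \<gamma> = (\<lambda>m. \<alpha> *s ket 0 L m + \<beta> *s ket 0 S m + \<gamma> *s ket 0 R m)"

text \<open>
  The terms are nonnegative, so \<open>infsum\<close> is the usual value of the series if it converges
  and \<open>0\<close> otherwise.
\<close>

definition absorb_prob :: "complex \<Rightarrow> complex \<Rightarrow> complex \<Rightarrow> real" where
  "absorb_prob \<alpha> \<beta> \<gamma> =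
     (\<Sum>\<^sub>\<infinity>t\<in>{1::nat..}.
        (ell2_norm (proj_yes (-1) (evolve
           (((\<lambda>\<phi>. proj_no (-1) (evolve \<phi>)) ^^ (t - 1)) (initial_state \<alpha> \<beta> \<gamma>)))))\<^sup>2)"

lemma sum_coin: "(\<Sum>c\<in>UNIV. f c) = f L + f S + f R" for f :: "coin \<Rightarrow> 'a::comm_monoid_add"
  by (simp add: UNIV_coin add.assoc)

lemma norm_coin_sq: "(norm v)\<^sup>2 = (cmod (v $ L))\<^sup>2 + (cmod (v $ S))\<^sup>2 + (cmod (v $ R))\<^sup>2"
  for v :: "complex ^ coin"
  by (simp add: norm_vec_def L2_set_def sum_coin)

lemma shift_ket:
  "shift (ket m L) = ket (m - 1) L" "shift (ket m S) = ket m S" "shift (ket m R) = ket (m + 1) R"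
  by (auto simp: shift_def ket_def fun_eq_iff vec_eq_iff axis_def split: coin.splits)

lemma coin_op_ket:
  "coin_op (ket m L) = (\<lambda>k. (- 1 / 3) *s ket m L k + (2 / 3) *s ket m S k + (2 / 3) *s ket m R k)"
  "coin_op (ket m S) = (\<lambda>k. (2 / 3) *s ket m L k + (- 1 / 3) *s ket m S k + (2 / 3) *s ket m R k)"
  "coin_op (ket m R) = (\<lambda>k. (2 / 3) *s ket m L k + (2 / 3) *s ket m S k + (- 1 / 3) *s ket m R k)"
  by (auto simp: coin_op_def ket_def fun_eq_iff vec_eq_iff axis_def grover_matrix_def
      matrix_vector_mult_def sum_coin) (metis coin.exhaust)+

lemma norm_grover: "norm (grover_matrix *v v) = norm v"
proof -
  have "(norm (grover_matrix *v v))\<^sup>2 = (norm v)\<^sup>2"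
    by (simp add: norm_coin_sq grover_matrix_def matrix_vector_mult_def sum_coin cmod_power2)
      (simp add: power2_eq_square field_simps)
  then show ?thesis by simp
qed

lemma coin_op_ell2: "\<psi> \<in> ell2 \<Longrightarrow> coin_op \<psi> \<in> ell2"
  and ell2_norm_coin_op: "ell2_norm (coin_op \<psi>) = ell2_norm \<psi>"
  by (simp_all add: ell2_def ell2_norm_def coin_op_def norm_grover)

lemma
  assumes "\<psi> \<in> ell2"
  shows shift_ell2: "shift \<psi> \<in> ell2" and ell2_norm_shift: "ell2_norm (shift \<psi>) = ell2_norm \<psi>"
proof -
  define f where "f c m = (cmod (\<psi> m $ c))\<^sup>2" for c m
  have summ: "f c summable_on UNIV" for c
    using assms unfolding ell2_def f_def mem_Collect_eq
    by (rule summable_on_comparison_test) (auto intro!: power_mono Finite_Cartesian_Product.norm_nth_le)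
  have hs: "(f c has_sum infsum (f c) UNIV) UNIV" for c
    using summ by simp
  have tr: "((\<lambda>m. f c (m + a)) has_sum infsum (f c) UNIV) UNIV" for c a
    using hs[of c] has_sum_reindex[of "\<lambda>m. m + a" UNIV "f c" "infsum (f c) UNIV"]
    by (auto simp: o_def)
  have "((\<lambda>m. f L m + f S m + f R m) has_sum
      (infsum (f L) UNIV + infsum (f S) UNIV + infsum (f R) UNIV)) UNIV"
    by (intro has_sum_add hs)
  then have 1: "((\<lambda>m. (norm (\<psi> m))\<^sup>2) has_sum
      (infsum (f L) UNIV + infsum (f S) UNIV + infsum (f R) UNIV)) UNIV"
    by (simp add: norm_coin_sq f_def)
  have "((\<lambda>m. f L (m + 1) + f S (m + 0) + f R (m + (- 1))) has_sum
      (infsum (f L) UNIV + infsum (f S) UNIV + infsum (f R) UNIV)) UNIV"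
    by (intro has_sum_add tr)
  then have 2: "((\<lambda>m. (norm (shift \<psi> m))\<^sup>2) has_sum
      (infsum (f L) UNIV + infsum (f S) UNIV + infsum (f R) UNIV)) UNIV"
    by (simp add: norm_coin_sq f_def shift_def)
  show "shift \<psi> \<in> ell2"
    using 2 by (auto simp: ell2_def summable_on_def)
  show "ell2_norm (shift \<psi>) = ell2_norm \<psi>"
    using 1 2 by (simp add: ell2_norm_def infsumI)
qed

lemma evolve_ell2: "\<psi> \<in> ell2 \<Longrightarrow> evolve \<psi> \<in> ell2"
  and ell2_norm_evolve: "\<psi> \<in> ell2 \<Longrightarrow> ell2_norm (evolve \<psi>) = ell2_norm \<psi>"
  by (simp_all add: evolve_def coin_op_ell2 shift_ell2 ell2_norm_shift ell2_norm_coin_op)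

lemma proj_yes_ell2: "\<psi> \<in> ell2 \<Longrightarrow> proj_yes n \<psi> \<in> ell2"
  and proj_no_ell2: "\<psi> \<in> ell2 \<Longrightarrow> proj_no n \<psi> \<in> ell2"
  by (auto simp: ell2_def proj_yes_def proj_no_def elim!: summable_on_comparison_test)

lemma initial_state_ell2: "initial_state \<alpha> \<beta> \<gamma> \<in> ell2"
proof -
  have "(\<lambda>m. (norm (initial_state \<alpha> \<beta> \<gamma> m))\<^sup>2) summable_on {0}" by simp
  then show ?thesis
    unfolding ell2_def mem_Collect_eq
    by (rule summable_on_cong_neutral[THEN iffD1, rotated -1])
      (auto simp: initial_state_def ket_def)
qed

end

(*
  Let F(z) be the generating function of the amplitudes absorbed at -1. The half-line walk is solved
  by a geometric profile in the position, which shows that F satisfies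
  2 z F^2 - (3 z^2 - 2 z + 3) F + 2 z = 0, i.e. F + 1/F = (3 z + 3/z - 2) / 2. By Parseval the
  absorbing probability is the mean of |F|^2 over the unit circle. At z = e^(it) the equation has the
  real middle coefficient 3 cos t - 1, so |F| = 1 if cos t >= -1/3; otherwise F is the real root of
  modulus at most 1. The substitution w = sqrt 3 * cos (t/2) makes the remaining integral elementary,
  and the probability is (10 sqrt 2 - 3 arccos (-1/3)) / (4 pi) = 0.669265...
*)

theory Submission
  imports Defs "HOL-Complex_Analysis.Complex_Analysis"
begin

section \<open>Parseval on the closed disc\<close>

lemma has_integral_cis_int_mult:
  fixes k :: int
  assumes "k \<noteq> 0"
  shows "((\<lambda>t. cis (of_int k * t)) has_integral 0) {0..2 * pi}"
proof -
  have "((\<lambda>t. cis (of_int k * t)) has_integral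
      cis (of_int k * (2 * pi)) / (\<i> * of_int k) - cis (of_int k * 0) / (\<i> * of_int k)) {0..2 * pi}"
  proof (rule fundamental_theorem_of_calculus)
    fix t :: real
    have "((\<lambda>z. exp (\<i> * of_int k * z) / (\<i> * of_int k)) has_field_derivative
        exp (\<i> * of_int k * of_real t)) (at (of_real t))"
      using assms by (auto intro!: derivative_eq_intros)
    from has_vector_derivative_real_field[OF this]
    show "((\<lambda>t. cis (of_int k * t) / (\<i> * of_int k)) has_vector_derivative cis (of_int k * t))
        (at t within {0..2 * pi})"
      by (simp add: cis_conv_exp mult.assoc)
  qed simp
  moreover have "cis (of_int k * (2 * pi)) = 1"
    by (metis cis_multiple_2pi Ints_of_int mult.commute)
  ultimately show ?thesis by simp
qed

text \<open>Each new term adds its own squared modulus and twice the real part of a combination of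
  characters \<open>cis (k * t)\<close> with k a nonzero integer, and these integrate to 0.\<close>

lemma has_integral_cmod_trig_poly:
  fixes a :: "nat \<Rightarrow> complex"
  shows "((\<lambda>t. (cmod (\<Sum>n<N. a n * cis t ^ n))\<^sup>2) has_integral 2 * pi * (\<Sum>n<N. (cmod (a n))\<^sup>2)) {0..2 * pi}"
proof (induction N)
  case 0
  show ?case by simp
next
  case (Suc N)
  let ?P = "\<lambda>t. \<Sum>n<N. a n * cis t ^ n"
  have cross: "?P t * cnj (a N * cis t ^ N) =
      (\<Sum>n<N. a n * cnj (a N) * cis (of_int (int n - int N) * t))" for t
  proof -
    have eq: "a n * cis t ^ n * cnj (a N * cis t ^ N) = a n * cnj (a N) * cis (of_int (int n - int N) * t)" for n
    proof -
      have "cis (of_int (int n - int N) * t) = cis (real n * t) * cis (- (real N * t))"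
        by (simp add: cis_mult left_diff_distrib)
      then show ?thesis by (simp add: Complex.DeMoivre cis_cnj)
    qed
    show ?thesis by (simp only: sum_distrib_right eq)
  qed
  have "((\<lambda>t. \<Sum>n<N. a n * cnj (a N) * cis (of_int (int n - int N) * t)) has_integral
      (\<Sum>n<N. a n * cnj (a N) * 0)) {0..2 * pi}"
    by (intro has_integral_sum has_integral_mult_right has_integral_cis_int_mult) auto
  then have "((\<lambda>t. ?P t * cnj (a N * cis t ^ N)) has_integral 0) {0..2 * pi}"
    unfolding cross by simp
  from has_integral_Re[OF this]
  have "((\<lambda>t. Re (?P t * cnj (a N * cis t ^ N))) has_integral 0) {0..2 * pi}"
    by (simp only: zero_complex.sel)
  from has_integral_mult_right[OF this, of 2]
  have 1: "((\<lambda>t. 2 * Re (?P t * cnj (a N * cis t ^ N))) has_integral 0) {0..2 * pi}" by simp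
  have 2: "((\<lambda>t. (cmod (a N))\<^sup>2) has_integral 2 * pi * (cmod (a N))\<^sup>2) {0..2 * pi}"
    using has_integral_const_real[of "(cmod (a N))\<^sup>2" 0 "2 * pi"] by simp
  have expand: "(cmod (?P t + a N * cis t ^ N))\<^sup>2 =
      (cmod (?P t))\<^sup>2 + (cmod (a N))\<^sup>2 + 2 * Re (?P t * cnj (a N * cis t ^ N))" for t
  proof -
    have "(cmod (u + v))\<^sup>2 = (cmod u)\<^sup>2 + (cmod v)\<^sup>2 + 2 * Re (u * cnj v)" for u v
      by (simp only: cmod_power2) (simp add: power2_eq_square algebra_simps)
    from this[of "?P t" "a N * cis t ^ N"] show ?thesis
      by (simp add: norm_mult norm_power)
  qed
  have "((\<lambda>t. (cmod (?P t + a N * cis t ^ N))\<^sup>2) has_integral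
      2 * pi * (\<Sum>n<N. (cmod (a n))\<^sup>2) + 2 * pi * (cmod (a N))\<^sup>2 + 0) {0..2 * pi}"
    unfolding expand by (intro has_integral_add Suc 1 2)
  then show ?case by (simp only: sum.lessThan_Suc distrib_left add_0_right)
qed

text \<open>Strictly inside the disc of convergence the partial sums converge uniformly on the
  circle, so the identity for trigonometric polynomials passes to the limit.\<close>

lemma has_integral_cmod_eval_fps_circle:
  assumes r: "0 \<le> r" "ereal r < fps_conv_radius F"
  obtains J where "((\<lambda>t. (cmod (eval_fps F (of_real r * cis t)))\<^sup>2) has_integral 2 * pi * J) {0..2 * pi}"
    "(\<lambda>n. (cmod (fps_nth F n))\<^sup>2 * r ^ (2 * n)) sums J"
proof -
  define p where "p N t = (\<Sum>n<N. (fps_nth F n * of_real r ^ n) * cis t ^ n)" for N t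
  have "uniform_limit (cball 0 r) (\<lambda>N z. \<Sum>n<N. fps_nth F n * (z - 0) ^ n)
      (\<lambda>z. \<Sum>n. fps_nth F n * (z - 0) ^ n) sequentially"
    using r by (intro powser_uniform_limit) (simp add: fps_conv_radius_def)
  from uniform_limit_compose'[OF this, of "\<lambda>t. of_real r * cis t" "{0..2 * pi}"]
  have lim: "uniform_limit {0..2 * pi} p (\<lambda>t. eval_fps F (of_real r * cis t)) sequentially"
    unfolding p_def eval_fps_def using r by (simp add: Pi_def norm_mult power_mult_distrib mult.assoc)
  have contp: "continuous_on {0..2 * pi} (p N)" for N
    unfolding p_def by (intro continuous_intros)
  have "continuous_on {0..2 * pi} (\<lambda>t. eval_fps F (of_real r * cis t))"
    by (rule uniform_limit_theorem[OF _ lim]) (use contp in auto)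
  \<comment> \<open>Products preserve uniform convergence when the limits are bounded; this yields
    convergence of the squared moduli.\<close>
  then have "bounded ((\<lambda>t. cmod (eval_fps F (of_real r * cis t))) ` {0..2 * pi})"
    by (intro compact_imp_bounded compact_continuous_image continuous_on_norm) auto
  then have "uniform_limit {0..2 * pi} (\<lambda>N t. cmod (p N t) * cmod (p N t))
      (\<lambda>t. cmod (eval_fps F (of_real r * cis t)) * cmod (eval_fps F (of_real r * cis t))) sequentially"
    by (intro uniform_lim_mult uniform_limit_norm lim)
  then obtain I K where IK: "\<And>N. ((\<lambda>t. cmod (p N t) * cmod (p N t)) has_integral I N) {0..2 * pi}"
    "((\<lambda>t. cmod (eval_fps F (of_real r * cis t)) * cmod (eval_fps F (of_real r * cis t))) has_integral K) {0..2 * pi}"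
    "I \<longlonglongrightarrow> K"
    by (rule uniform_limit_integral) (auto intro!: continuous_intros contp)
  have I: "I N = 2 * pi * (\<Sum>n<N. (cmod (fps_nth F n))\<^sup>2 * r ^ (2 * n))" for N
  proof -
    have "I N = 2 * pi * (\<Sum>n<N. (cmod (fps_nth F n * of_real r ^ n))\<^sup>2)"
      using has_integral_unique[OF IK(1)[of N, unfolded p_def, folded power2_eq_square]
          has_integral_cmod_trig_poly] .
    moreover have "(cmod (fps_nth F n * of_real r ^ n))\<^sup>2 = (cmod (fps_nth F n))\<^sup>2 * r ^ (2 * n)" for n
    proof -
      have "(r ^ n)\<^sup>2 = r ^ (2 * n)" by (simp only: power_mult[symmetric] mult.commute)
      then show ?thesis using r by (simp add: norm_mult norm_power power_mult_distrib)
    qed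
    ultimately show ?thesis by (simp only:)
  qed
  have "(\<lambda>N. I N / (2 * pi)) \<longlonglongrightarrow> K / (2 * pi)"
    using IK(3) by (rule tendsto_divide) auto
  moreover have "I N / (2 * pi) = (\<Sum>n<N. (cmod (fps_nth F n))\<^sup>2 * r ^ (2 * n))" for N
    unfolding I by (rule nonzero_mult_div_cancel_left) simp
  ultimately have "(\<lambda>n. (cmod (fps_nth F n))\<^sup>2 * r ^ (2 * n)) sums (K / (2 * pi))"
    unfolding sums_def by (simp only:)
  moreover have "2 * pi * (K / (2 * pi)) = K" by simp
  ultimately show thesis
    using that[of "K / (2 * pi)"] IK(2)[folded power2_eq_square] by (simp only:)
qed

text \<open>The radius of convergence may be exactly 1, so the identity is taken at radius r < 1 and
  r tends to 1. The circle means \<open>M r\<close> are continuous up to r = 1 because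
  \<open>f\<close> is. Since all \<open>a n\<close> are nonnegative, the sum is squeezed: partial
  sums are at most \<open>M 1\<close>, and each \<open>M r\<close> is at most the full sum.\<close>

lemma parseval_closed_disc:
  assumes rad: "fps_conv_radius F \<ge> 1" and cont: "continuous_on (cball 0 1) f"
    and eq: "\<And>z. cmod z < 1 \<Longrightarrow> eval_fps F z = f z"
  shows "(\<lambda>n. (cmod (fps_nth F n))\<^sup>2) sums (integral {0..2 * pi} (\<lambda>t. (cmod (f (cis t)))\<^sup>2) / (2 * pi))"
proof -
  define a where "a n = (cmod (fps_nth F n))\<^sup>2" for n
  define M where "M r = integral (cbox 0 (2 * pi)) (\<lambda>t. (cmod (f (of_real r * cis t)))\<^sup>2) / (2 * pi)" for r
  have sums: "(\<lambda>n. a n * r ^ (2 * n)) sums M r" if r: "r \<in> {0..<1}" for r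
  proof -
    have "ereal r < 1" using r by simp
    then have "ereal r < fps_conv_radius F" using rad by (rule less_le_trans)
    then obtain J where J: "((\<lambda>t. (cmod (eval_fps F (of_real r * cis t)))\<^sup>2) has_integral 2 * pi * J) {0..2 * pi}"
      "(\<lambda>n. (cmod (fps_nth F n))\<^sup>2 * r ^ (2 * n)) sums J"
      using has_integral_cmod_eval_fps_circle[of r F] r by auto
    have "eval_fps F (of_real r * cis t) = f (of_real r * cis t)" for t
      using r by (intro eq) (simp add: norm_mult)
    with J show ?thesis by (simp add: M_def a_def integral_unique)
  qed
  have contM: "continuous_on {0..1} M"
    unfolding M_def
  proof (intro continuous_intros integral_continuous_on_param)
    have "continuous_on ({0..1} \<times> cbox 0 (2 * pi)) (\<lambda>x. f (of_real (fst x) * cis (snd x)))"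
      by (rule continuous_on_compose2[OF cont])
        (auto intro!: continuous_intros simp: norm_mult)
    then show "continuous_on ({0..1} \<times> cbox 0 (2 * pi)) (\<lambda>(r, t). (cmod (f (of_real r * cis t)))\<^sup>2)"
      unfolding case_prod_beta by (intro continuous_intros)
  qed auto
  have "(M \<longlongrightarrow> M 1) (at 1 within {0..1})"
    using contM by (simp add: continuous_on_def)
  then have M1: "(M \<longlongrightarrow> M 1) (at_left 1)"
    using at_within_Icc_at_left[of 0 "1::real"] by simp
  have ev: "eventually (\<lambda>r::real. r \<in> {0..<1}) (at_left 1)"
    using eventually_at_left_real[of 0 "1::real"] by (auto elim: eventually_mono)
  have partial: "(\<Sum>n<N. a n) \<le> M 1" for N
  proof (rule tendsto_le[OF _ M1])
    show "((\<lambda>r. \<Sum>n<N. a n * r ^ (2 * n)) \<longlongrightarrow> (\<Sum>n<N. a n)) (at_left 1)"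
      by (auto intro!: tendsto_eq_intros)
    show "\<forall>\<^sub>F r in at_left 1. (\<Sum>n<N. a n * r ^ (2 * n)) \<le> M r"
      using ev
    proof eventually_elim
      case (elim r)
      have "(\<Sum>n<N. a n * r ^ (2 * n)) \<le> (\<Sum>n. a n * r ^ (2 * n))"
        using sums[OF elim] elim by (intro sum_le_suminf) (auto simp: sums_iff a_def)
      then show ?case using sums[OF elim] by (simp add: sums_iff)
    qed
  qed auto
  have summ: "summable a"
    by (rule summableI_nonneg_bounded[of _ "M 1"]) (use partial in \<open>auto simp: a_def\<close>)
  have "M 1 \<le> suminf a"
  proof (rule tendsto_upperbound[OF M1])
    show "\<forall>\<^sub>F r in at_left 1. M r \<le> suminf a"
      using ev
    proof eventually_elim
      case (elim r)
      have "a n * r ^ (2 * n) \<le> a n" for n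
        using elim by (intro mult_left_le power_le_one) (auto simp: a_def)
      then have "(\<Sum>n. a n * r ^ (2 * n)) \<le> suminf a"
        using sums[OF elim] summ by (intro suminf_le) (auto simp: sums_iff)
      then show ?case using sums[OF elim] by (simp add: sums_iff)
    qed
  qed auto
  moreover have "suminf a \<le> M 1"
    using summ partial by (intro suminf_le_const) auto
  ultimately show ?thesis
    using summable_sums[OF summ] by (simp add: M_def a_def[abs_def])
qed

section \<open>The generating function\<close>

text \<open>The discriminant of the quadratic for F is (3 z^2 - 2 z + 3)^2 - 16 z^2 = (1 - z)^2 (9
  z^2 + 6 z + 9). This is the zero of the last factor in the upper half plane; the other zero is its
  conjugate.\<close>

definition absorb_branch :: complex where
  "absorb_branch = Complex (- 1 / 3) (sqrt 8 / 3)"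

text \<open>A branch of the square root of 9 z^2 + 6 z + 9. Taking \<open>csqrt\<close> of each
  linear factor separately keeps its argument in the closed right half plane for |z| <= 1, so the
  cut is never crossed.\<close>

definition absorb_root :: "complex \<Rightarrow> complex" where
  "absorb_root z = 3 * (csqrt (1 - absorb_branch * z) * csqrt (1 - cnj absorb_branch * z))"

definition absorb_den :: "complex \<Rightarrow> complex" where
  "absorb_den z = 3 * z\<^sup>2 - 2 * z + 3 + (1 - z) * absorb_root z"

text \<open>With b = 3 z^2 - 2 z + 3 and s = (1 - z) * \<open>absorb_root z\<close>, this is the
  root (b - s) / (4 z) rewritten as 4 z / (b + s), which is regular at 0.\<close>

definition absorb_gf :: "complex \<Rightarrow> complex" where
  "absorb_gf z = 4 * z / absorb_den z"

lemma norm_absorb_branch: "cmod absorb_branch = 1"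
  by (simp add: absorb_branch_def cmod_def power_divide)

lemma absorb_root_square: "(absorb_root z)\<^sup>2 = 9 * z\<^sup>2 + 6 * z + 9"
proof -
  have "absorb_branch * cnj absorb_branch = 1"
    by (metis complex_norm_square norm_absorb_branch of_real_1 one_power2)
  moreover have "absorb_branch + cnj absorb_branch = - 2 / 3"
    by (simp add: absorb_branch_def complex_eq_iff)
  ultimately have "(1 - absorb_branch * z) * (1 - cnj absorb_branch * z) = z\<^sup>2 + 2 / 3 * z + 1"
    by algebra
  then show ?thesis by (simp add: absorb_root_def power_mult_distrib algebra_simps)
qed

text \<open>If b + s = 0, then b^2 = s^2, and as b^2 - s^2 = 16 z^2 this leaves only z = 0, where
  the denominator is 6.\<close>

lemma absorb_den_nonzero: "absorb_den z \<noteq> 0"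
proof
  assume 0: "absorb_den z = 0"
  have "(3 * z\<^sup>2 - 2 * z + 3)\<^sup>2 = (1 - z)\<^sup>2 * (absorb_root z)\<^sup>2"
    using 0 unfolding absorb_den_def by algebra
  then have "16 * z\<^sup>2 = 0"
    unfolding absorb_root_square by algebra
  with 0 show False by (simp add: absorb_den_def absorb_root_def)
qed

lemma absorb_gf_quadratic:
  "2 * z * (absorb_gf z)\<^sup>2 - (3 * z\<^sup>2 - 2 * z + 3) * absorb_gf z + 2 * z = 0"
proof -
  have "absorb_gf z * absorb_den z = 4 * z"
    using absorb_den_nonzero by (simp add: absorb_gf_def)
  \<comment> \<open>The denominator b + s is a root of y^2 - 2 b y + 16 z^2, because s^2 = b^2 - 16
    z^2.\<close>
  moreover have "(absorb_den z)\<^sup>2 - 2 * (3 * z\<^sup>2 - 2 * z + 3) * absorb_den z + 16 * z\<^sup>2 = 0"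
    using absorb_root_square[of z] unfolding absorb_den_def by algebra
  ultimately have "(absorb_den z)\<^sup>2 *
      (2 * z * (absorb_gf z)\<^sup>2 - (3 * z\<^sup>2 - 2 * z + 3) * absorb_gf z + 2 * z) = 0"
    by algebra
  then show ?thesis using absorb_den_nonzero by simp
qed

text \<open>The closed right half plane meets the cut only at 0, and there the modulus of
  \<open>csqrt\<close> tends to 0.\<close>

lemma continuous_on_csqrt_Re_nonneg: "continuous_on {w. 0 \<le> Re w} csqrt"
proof (rule continuous_at_imp_continuous_on, rule ballI)
  fix w :: complex
  assume w: "w \<in> {w. 0 \<le> Re w}"
  show "isCont csqrt w"
  proof (cases "w = 0")
    case True
    have "((\<lambda>z. cmod (csqrt z)) \<longlongrightarrow> 0) (at 0)"
      by (auto intro!: tendsto_eq_intros)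
    then have "(csqrt \<longlongrightarrow> 0) (at 0)"
      by (rule tendsto_norm_zero_cancel)
    then show ?thesis by (simp add: True isCont_def)
  next
    case False
    with w show ?thesis
      by (intro continuous_at_csqrt) (auto simp: complex_nonpos_Reals_iff complex_eq_iff)
  qed
qed

lemma continuous_on_absorb_gf: "continuous_on (cball 0 1) absorb_gf"
proof -
  have c: "continuous_on (cball 0 1) (\<lambda>z. csqrt (1 - u * z))" if "cmod u = 1" for u
  proof (rule continuous_on_compose2[OF continuous_on_csqrt_Re_nonneg])
    show "(\<lambda>z. 1 - u * z) ` cball 0 1 \<subseteq> {w. 0 \<le> Re w}"
    proof (rule image_subsetI)
      fix z :: complex assume "z \<in> cball 0 1"
      then have "cmod (u * z) \<le> 1" using that by (simp add: norm_mult)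
      then have "Re (u * z) \<le> 1" using complex_Re_le_cmod order_trans by blast
      then show "1 - u * z \<in> {w. 0 \<le> Re w}" by simp
    qed
  qed (intro continuous_intros)
  show ?thesis
    unfolding absorb_gf_def absorb_den_def absorb_root_def
    by (intro continuous_intros c)
      (use norm_absorb_branch absorb_den_nonzero in \<open>auto simp: absorb_den_def absorb_root_def\<close>)
qed

lemma holomorphic_on_absorb_gf: "absorb_gf holomorphic_on ball 0 1"
proof -
  have c: "(\<lambda>z. csqrt (1 - u * z)) holomorphic_on ball 0 1" if "cmod u = 1" for u
  proof (intro holomorphic_intros)
    fix z :: complex assume "z \<in> ball 0 1"
    then have "cmod (u * z) < 1" using that by (simp add: norm_mult)
    then have "Re (u * z) < 1" using complex_Re_le_cmod le_less_trans by blast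
    then show "1 - u * z \<notin> \<real>\<^sub>\<le>\<^sub>0" by (simp add: complex_nonpos_Reals_iff)
  qed
  show ?thesis
    unfolding absorb_gf_def absorb_den_def absorb_root_def
    by (intro holomorphic_intros c)
      (use norm_absorb_branch absorb_den_nonzero in \<open>auto simp: absorb_den_def absorb_root_def\<close>)
qed

text \<open>If $|f(z)| = 1$ then $f + 1/f \in [-2, 2]$, which makes $z + 1/z$ real and forces $|z| = 1$.\<close>

lemma norm_absorb_gf_neq_1:
  assumes "cmod z < 1"
  shows "cmod (absorb_gf z) \<noteq> 1"
proof
  assume 1: "cmod (absorb_gf z) = 1"
  define w where "w = absorb_gf z"
  have wc: "w * cnj w = 1"
    using 1 by (metis complex_norm_square of_real_1 one_power2 w_def)
  \<comment> \<open>Since 1/w = \<open>cnj w\<close>, dividing the quadratic by z w gives 3 (z +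
    1/z) = 2 (2 Re w + 1), so \<open>k\<close> is the value of z + 1/z.\<close>
  define k where "k = 2 / 3 * (2 * Re w + 1)"
  have "2 * z * w\<^sup>2 - (3 * z\<^sup>2 - 2 * z + 3) * w + 2 * z = 0"
    unfolding w_def by (rule absorb_gf_quadratic)
  then have "3 * (z\<^sup>2 + 1) = 2 * z * (w + cnj w + 1)"
    using wc by algebra
  moreover have "3 * of_real k = 2 * (of_real (2 * Re w) + 1 :: complex)"
    by (simp add: k_def)
  moreover note complex_add_cnj[of w]
  ultimately have "3 * (z\<^sup>2 + 1) = 3 * (of_real k * z)"
    by algebra
  then have eq: "z\<^sup>2 + 1 = of_real k * z"
    by (simp only: mult_cancel_left) simp
  have "\<bar>Re w\<bar> \<le> 1" using abs_Re_le_cmod[of w] 1 by (simp add: w_def)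
  then have k: "- 2 / 3 \<le> k" "k \<le> 2" by (auto simp: k_def)
  define x y where "x = Re z" and "y = Im z"
  have im: "y * (2 * x - k) = 0" and re: "x\<^sup>2 - y\<^sup>2 + 1 = k * x"
    using eq by (auto simp: complex_eq_iff x_def y_def power2_eq_square algebra_simps)
  have xy: "x\<^sup>2 + y\<^sup>2 < 1"
    using assms by (simp add: x_def y_def cmod_def real_sqrt_less_iff)
  show False
  \<comment> \<open>For real z, z^2 + 1 = k z with k <= 2 contradicts (1 - |z|)^2 > 0; for nonreal
    z, the two roots are conjugate with product 1, so |z| = 1.\<close>
  proof (cases "y = 0")
    case True
    have x: "\<bar>x\<bar> < 1" using xy True by (simp add: abs_square_less_1)
    have "\<bar>k * x\<bar> \<le> 2 * \<bar>x\<bar>" using k by (auto simp: abs_mult intro!: mult_right_mono)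
    moreover have "(1 - \<bar>x\<bar>)\<^sup>2 > 0" using x by simp
    ultimately show False using re True by (auto simp: power2_eq_square algebra_simps abs_if split: if_splits)
  next
    case False
    then have "k = 2 * x" using im by simp
    with re xy show False by (simp add: power2_eq_square)
  qed
qed

text \<open>On the connected open disc |F| starts at 0 and never equals 1, hence stays below 1;
  continuity extends the bound to the boundary.\<close>

lemma norm_absorb_gf_le_1:
  assumes "cmod z \<le> 1"
  shows "cmod (absorb_gf z) \<le> 1"
proof -
  have *: "cmod (absorb_gf u) < 1" if "cmod u < 1" for u
  proof (rule ccontr)
    assume "\<not> ?thesis"
    then have ge: "1 \<le> cmod (absorb_gf u)" by simp
    let ?I = "(\<lambda>z. cmod (absorb_gf z)) ` ball 0 1"
    have "connected ?I"
      by (intro connected_continuous_image continuous_on_norm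
          continuous_on_subset[OF continuous_on_absorb_gf]) auto
    moreover have "0 \<in> ?I" by (rule image_eqI[of _ _ 0]) (simp_all add: absorb_gf_def)
    moreover have "cmod (absorb_gf u) \<in> ?I" by (rule imageI) (use that in simp)
    ultimately have "1 \<in> ?I" using connectedD_interval ge zero_le_one by blast
    then show False using norm_absorb_gf_neq_1 by auto
  qed
  have "absorb_gf ` closure (ball 0 1) \<subseteq> closure (ball 0 1)"
    by (rule image_closure_subset) (use continuous_on_absorb_gf less_imp_le[OF *] in auto)
  then have "absorb_gf z \<in> closure (ball 0 1)" using assms by (auto simp: image_subset_iff)
  then show ?thesis by simp
qed

text \<open>On the circle z + 1/z = 2 cos t, so w = F(z) solves w^2 + 2 x w + 1 = 0 with x real and
  x >= -1. For x <= 1 both roots have modulus 1. For x > 1 they are real with product 1, and |w| <=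
  1 selects -x + sqrt (x^2 - 1).\<close>

lemma norm_absorb_gf_cis:
  fixes t :: real
  defines "x \<equiv> (1 - 3 * cos t) / 2"
  shows "(cmod (absorb_gf (cis t)))\<^sup>2 = (if x \<le> 1 then 1 else (x - sqrt (x\<^sup>2 - 1))\<^sup>2)"
proof -
  define w where "w = absorb_gf (cis t)"
  have "cis t + cnj (cis t) = of_real (2 * cos t)" "cis t * cnj (cis t) = 1"
    by (simp_all add: complex_eq_iff cis_mult cis_cnj)
  moreover have "2 * cis t * w\<^sup>2 - (3 * (cis t)\<^sup>2 - 2 * cis t + 3) * w + 2 * cis t = 0"
    unfolding w_def by (rule absorb_gf_quadratic)
  ultimately have "w\<^sup>2 - (3 * of_real (cos t) - 1) * w + 1 = 0"
    by simp algebra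
  moreover have "of_real (2 * x) = 1 - 3 * (of_real (cos t) :: complex)" by (simp add: x_def)
  ultimately have w: "w\<^sup>2 + of_real (2 * x) * w + 1 = 0"
    by algebra
  have wle: "cmod w \<le> 1" unfolding w_def by (rule norm_absorb_gf_le_1) simp
  define u v where "u = Re w" and "v = Im w"
  have im: "v * (u + x) = 0" and re: "u\<^sup>2 - v\<^sup>2 + 2 * x * u + 1 = 0"
    using w by (auto simp: complex_eq_iff u_def v_def power2_eq_square algebra_simps)
  have uv: "u\<^sup>2 + v\<^sup>2 \<le> 1" using power_le_one[OF _ wle, of 2] by (simp add: cmod_power2 u_def v_def)
  have n: "(cmod w)\<^sup>2 = u\<^sup>2 + v\<^sup>2" by (simp add: cmod_power2 u_def v_def)
  have xge: "x \<ge> - 1" by (simp add: x_def)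
  have "u\<^sup>2 + v\<^sup>2 = (if x \<le> 1 then 1 else (x - sqrt (x\<^sup>2 - 1))\<^sup>2)"
  proof (cases "v = 0")
    case True
    have sq: "(u + x)\<^sup>2 = x\<^sup>2 - 1" using re True by (simp add: power2_eq_square algebra_simps)
    then have "x\<^sup>2 \<ge> 1" by (metis zero_le_power2 diff_ge_0_iff_ge)
    then have x1: "\<bar>x\<bar> \<ge> 1" by (simp add: abs_le_square_iff[of 1, simplified])
    show ?thesis
    proof (cases "x \<le> 1")
      case True
      then have "x = 1 \<or> x = - 1" using x1 xge by linarith
      then have "x\<^sup>2 = 1" by auto
      with sq have "u\<^sup>2 = 1" by (simp add: eq_neg_iff_add_eq_0[symmetric])
      then show ?thesis using True \<open>v = 0\<close> by simp
    next
      case False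
      have u: "u \<ge> - 1" using uv True by (simp add: abs_square_le_1)
      then have "\<bar>u + x\<bar> = u + x" using False by simp
      then have "sqrt (x\<^sup>2 - 1) = u + x" using sq by (metis real_sqrt_abs)
      then show ?thesis using False \<open>v = 0\<close> by simp
    qed
  next
    case False
    then have ux: "u = - x" using im by simp
    then have "x\<^sup>2 + v\<^sup>2 = 1" using re by (simp add: power2_eq_square)
    moreover from this False have "x\<^sup>2 < 1"
      by (metis add.commute less_add_same_cancel2 zero_less_power2)
    then have "x < 1" by (simp add: power2_less_1_iff abs_square_less_1)
    ultimately show ?thesis using ux by simp
  qed
  then show ?thesis using n w_def by simp
qed

section \<open>The integral over the unit circle\<close>

text \<open>The derivative is the integrand that the cross term -2 x sqrt (x^2 - 1) dt becomes under
  w = sqrt 3 * cos (t/2).\<close>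

lemma has_real_derivative_boundary_primitive:
  fixes w :: real
  assumes "\<bar>w\<bar> < 1"
  shows "((\<lambda>w. 7 / 2 * arcsin w + (9 / 2 * w - w ^ 3) * sqrt (1 - w\<^sup>2)) has_real_derivative
    4 * (2 - w\<^sup>2) * sqrt (1 - w\<^sup>2)) (at w)"
proof -
  define s where "s = sqrt (1 - w\<^sup>2)"
  have "w\<^sup>2 < 1" using assms by (simp add: abs_square_less_1)
  then have s: "s > 0" "s * s = 1 - w\<^sup>2" by (auto simp: s_def)
  have "7 / 2 * inverse s + ((9 / 2 - 3 * w\<^sup>2) * s + (9 / 2 * w - w ^ 3) * (- (2 * w) * inverse s / 2))
      = (7 / 2 + (9 / 2 - 3 * w\<^sup>2) * (s * s) - (9 / 2 * w - w ^ 3) * w) / s"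
    using s(1) by (simp add: field_simps)
  also have "7 / 2 + (9 / 2 - 3 * w\<^sup>2) * (s * s) - (9 / 2 * w - w ^ 3) * w = 4 * (2 - w\<^sup>2) * (s * s)"
    unfolding s(2) by (simp add: power2_eq_square power3_eq_cube field_simps)
  also have "4 * (2 - w\<^sup>2) * (s * s) / s = 4 * (2 - w\<^sup>2) * s" using s(1) by simp
  finally have "7 / 2 * inverse s + ((9 / 2 - 3 * w\<^sup>2) * s + (9 / 2 * w - w ^ 3) * (- (2 * w) * inverse s / 2))
      = 4 * (2 - w\<^sup>2) * s" .
  moreover have "((\<lambda>w. 7 / 2 * arcsin w + (9 / 2 * w - w ^ 3) * sqrt (1 - w\<^sup>2)) has_real_derivative
      7 / 2 * inverse s + ((9 / 2 - 3 * w\<^sup>2) * s + (9 / 2 * w - w ^ 3) * (- (2 * w) * inverse s / 2))) (at w)"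
    using assms \<open>w\<^sup>2 < 1\<close> unfolding s_def
    by (auto intro!: derivative_eq_intros)
  ultimately show ?thesis by (simp add: s_def)
qed

text \<open>With cos a = -1/3, the integrand is 1 on the two outer arcs, which contribute 2 a. On
  the middle arc it expands to 2 x^2 - 1 - 2 x sqrt (x^2 - 1).\<close>

lemma has_integral_boundary_modulus:
  fixes x :: "real \<Rightarrow> real"
  defines "x \<equiv> \<lambda>t. (1 - 3 * cos t) / 2"
  shows "((\<lambda>t. if x t \<le> 1 then 1 else (x t - sqrt ((x t)\<^sup>2 - 1))\<^sup>2) has_integral
    5 * sqrt 2 - 3 / 2 * arccos (- 1 / 3)) {0..2 * pi}"
proof -
  define a where "a = arccos (- 1 / 3)"
  define g where "g t = (if x t \<le> 1 then 1 else (x t - sqrt ((x t)\<^sup>2 - 1))\<^sup>2)" for t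
  define w where "w t = sqrt 3 * cos (t / 2)" for t :: real
  define K where "K w = 7 / 2 * arcsin w + (9 / 2 * w - w ^ 3) * sqrt (1 - w\<^sup>2)" for w :: real
  \<comment> \<open>The trigonometric part is a primitive of 2 x^2 - 1, and \<open>K (w t)\<close>
    is one of the cross term.\<close>
  define H where "H t = 7 / 4 * t - 3 * sin t + 9 / 8 * sin (2 * t) + K (w t)" for t
  have a: "0 < a" "a < pi" "cos a = - 1 / 3"
    using arccos_lt_bounded[of "- 1 / 3"] by (auto simp: a_def)
  have sina: "sin a = 2 * sqrt 2 / 3"
  proof -
    have "sin a = sqrt (1 - (cos a)\<^sup>2)"
      using a by (intro sin_cos_sqrt) (auto intro: sin_ge_zero)
    also have "1 - (cos a)\<^sup>2 = (2 * sqrt 2 / 3)\<^sup>2"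
      using a by (simp add: power_divide power_mult_distrib)
    finally show ?thesis by simp
  qed
  have cosd: "cos t = 2 * (cos (t / 2))\<^sup>2 - 1" for t :: real
    using cos_double_cos[of "t / 2"] by simp
  have x_w: "x t = 2 - (w t)\<^sup>2" for t
    unfolding x_def w_def by (subst cosd) (simp add: power_mult_distrib)
  have "(w a)\<^sup>2 = 1" using x_w[of a] a(3) by (simp add: x_def)
  moreover have "w a > 0" using a unfolding w_def by (auto intro!: mult_pos_pos cos_gt_zero)
  ultimately have wa: "w a = 1" by (simp add: power2_eq_1_iff)
  have wr: "w (2 * pi - t) = - w t" for t
    by (simp add: w_def diff_divide_distrib cos_diff)
  have cosr: "cos (2 * pi - t) = cos t" for t :: real
    by (simp add: cos_diff)
  have wmono: "w t < w s" if "0 \<le> s" "s < t" "t \<le> 2 * pi" for s t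
    using that unfolding w_def by (auto intro!: cos_monotone_0_pi)
  have w_mid: "\<bar>w t\<bar> < 1" if "t \<in> {a<..<2 * pi - a}" for t
    using wmono[of a t] wmono[of t "2 * pi - a"] that a wa wr[of a] by auto
  have w_mid': "w t \<in> {-1..1}" if "t \<in> {a..2 * pi - a}" for t
    using w_mid[of t] that wa wr[of a] a by (cases "t = a \<or> t = 2 * pi - a") auto
  have i1: "((\<lambda>_. 1 :: real) has_integral a) {0..a}"
    using has_integral_const_real[of "1::real" 0 a] a by simp
  have "1 = g t" if "t \<in> {0..a}" for t
  proof -
    have "cos a \<le> cos t" using that a by (intro cos_monotone_0_pi_le) auto
    then show ?thesis using a by (simp add: g_def x_def)
  qed
  then have 1: "(g has_integral a) {0..a}"
    by (rule has_integral_eq[OF _ i1])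
  have i3: "((\<lambda>_. 1 :: real) has_integral a) {2 * pi - a..2 * pi}"
    using has_integral_const_real[of "1::real" "2 * pi - a" "2 * pi"] a by simp
  have "1 = g t" if "t \<in> {2 * pi - a..2 * pi}" for t
  proof -
    have "cos a \<le> cos (2 * pi - t)" using that a by (intro cos_monotone_0_pi_le) auto
    then show ?thesis using a cosr[of t] by (simp add: g_def x_def)
  qed
  then have 3: "(g has_integral a) {2 * pi - a..2 * pi}"
    by (rule has_integral_eq[OF _ i3])
  have "(g has_integral H (2 * pi - a) - H a) {a..2 * pi - a}"
  \<comment> \<open>At the endpoints \<open>w\<close> is 1 and -1, where \<open>arcsin\<close> and
    the square root are not differentiable; continuity of \<open>H\<close> suffices there.\<close>
  proof (rule fundamental_theorem_of_calculus_interior)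
    show "a \<le> 2 * pi - a" using a by simp
    have "w t \<in> {-1..1} \<Longrightarrow> (w t)\<^sup>2 \<le> 1" for t by (auto simp: abs_square_le_1 abs_le_iff)
    then show "continuous_on {a..2 * pi - a} H"
      unfolding H_def K_def using w_mid'
      by (intro continuous_intros) (auto simp: w_def intro!: continuous_intros)
    fix t assume t: "t \<in> {a<..<2 * pi - a}"
    define s where "s = sqrt (1 - (w t)\<^sup>2)"
    have w2: "(w t)\<^sup>2 < 1" using w_mid[OF t] by (simp add: abs_square_less_1)
    have sin0: "sin (t / 2) \<ge> 0" using t a by (intro sin_ge_zero) auto
    have ss: "(sin (t / 2))\<^sup>2 = 1 - (cos (t / 2))\<^sup>2" by (rule sin_squared_eq)
    \<comment> \<open>Factor x^2 - 1 = (x - 1) (x + 1) = (1 - w^2) (3 - w^2), where 3 - w^2 = 3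
      sin^2 (t/2).\<close>
    have "(x t)\<^sup>2 - 1 = (1 - (w t)\<^sup>2) * (sqrt 3 * sin (t / 2))\<^sup>2"
      unfolding x_w by (simp add: power_mult_distrib ss w_def) (simp add: power2_eq_square algebra_simps)
    then have sq: "sqrt ((x t)\<^sup>2 - 1) = s * (sqrt 3 * sin (t / 2))"
      using sin0 by (simp add: real_sqrt_mult s_def real_sqrt_abs abs_mult)
    have "x t > 1" using w2 by (simp add: x_w)
    then have "g t = (x t - sqrt ((x t)\<^sup>2 - 1))\<^sup>2" by (simp add: g_def)
    also have "\<dots> = (x t)\<^sup>2 + (sqrt ((x t)\<^sup>2 - 1))\<^sup>2 - 2 * x t * sqrt ((x t)\<^sup>2 - 1)"
      by (simp add: power2_diff)
    also have "(sqrt ((x t)\<^sup>2 - 1))\<^sup>2 = (x t)\<^sup>2 - 1" using \<open>x t > 1\<close> by simp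
    finally have g: "g t = 2 * (x t)\<^sup>2 - 1 - 2 * x t * (s * (sqrt 3 * sin (t / 2)))"
      unfolding sq by simp
    have wd: "(w has_real_derivative - (sqrt 3 * sin (t / 2)) / 2) (at t)"
      unfolding w_def by (auto intro!: derivative_eq_intros)
    have Kd: "(K has_real_derivative 4 * (2 - (w t)\<^sup>2) * s) (at (w t))"
      unfolding K_def s_def by (rule has_real_derivative_boundary_primitive[OF w_mid[OF t]])
    have "((\<lambda>t. K (w t)) has_real_derivative 4 * (2 - (w t)\<^sup>2) * s * (- (sqrt 3 * sin (t / 2)) / 2)) (at t)"
      using DERIV_chain2[OF Kd wd] .
    then have "(H has_real_derivative 7 / 4 - 3 * cos t + 9 / 8 * (2 * cos (2 * t))
        + 4 * (2 - (w t)\<^sup>2) * s * (- (sqrt 3 * sin (t / 2)) / 2)) (at t)"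
      unfolding H_def by (auto intro!: derivative_eq_intros)
    moreover
    have "7 / 4 - 3 * cos t + 9 / 8 * (2 * cos (2 * t)) = 2 * (x t)\<^sup>2 - 1"
      unfolding x_def cos_double_cos by (simp add: power2_eq_square field_simps)
    then have "7 / 4 - 3 * cos t + 9 / 8 * (2 * cos (2 * t))
        + 4 * (2 - (w t)\<^sup>2) * s * (- (sqrt 3 * sin (t / 2)) / 2) = g t"
      unfolding g x_w[symmetric] by simp
    ultimately have "(H has_real_derivative g t) (at t)"
      by (simp only:)
    then show "(H has_vector_derivative g t) (at t)"
      by (simp add: has_real_derivative_iff_has_vector_derivative)
  qed
  \<comment> \<open>The \<open>arcsin\<close> terms contribute -7/2 pi, cancelling the pi from the
    linear term; the sines give 4 sqrt 2 + sqrt 2.\<close>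
  moreover have "H (2 * pi - a) - H a = 5 * sqrt 2 - 7 / 2 * a"
  proof -
    have "sin (2 * a) = - 4 * sqrt 2 / 9"
      unfolding sin_double sina a(3) by simp
    moreover define u where "u = sin (2 * (2 * pi - a))"
    moreover have "u = - sin (2 * a)"
      unfolding u_def sin_double cosr by (simp add: sin_diff)
    moreover have "w (2 * pi - a) = - 1" "sin (2 * pi - a) = - sin a"
      by (simp_all add: wr wa sin_diff)
    ultimately show ?thesis
      unfolding H_def K_def u_def[symmetric] by (simp add: wa sina field_simps)
  qed
  ultimately have 2: "(g has_integral 5 * sqrt 2 - 7 / 2 * a) {a..2 * pi - a}" by simp
  have "(g has_integral a + (5 * sqrt 2 - 7 / 2 * a)) {0..2 * pi - a}"
    by (rule has_integral_combine[OF _ _ 1 2]) (use a in auto)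
  from has_integral_combine[OF _ _ this 3] a
  have "(g has_integral a + (5 * sqrt 2 - 7 / 2 * a) + a) {0..2 * pi}" by simp
  then show ?thesis by (simp add: g_def[abs_def] a_def algebra_simps)
qed

section \<open>Numerical evaluation of the closed form\<close>

lemma sin_Maclaurin_5: "\<bar>sin x - (x - x ^ 3 / 6 + x ^ 5 / 120)\<bar> \<le> \<bar>x\<bar> ^ 7 / 5040" for x :: real
  using Maclaurin_sin_bound[of x 7]
  by (simp add: sin_coeff_def lessThan_nat_numeral fact_numeral algebra_simps)

text \<open>The offset from pi/2 is d = arcsin (1/3) = 0.33983..., enclosed by evaluating the Taylor
  polynomial of the sine at both bounds. Keeping pi/2 symbolic turns the closed form into (5 sqrt 2
  - 3/2 d) / (2 pi) - 3/8.\<close>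

lemma arccos_minus_third_bounds:
  "arccos (- 1 / 3) < pi / 2 + 0.33985" "pi / 2 + 0.3397 < arccos (- 1 / 3)"
proof -
  have eq: "arccos (- 1 / 3) = pi / 2 + arcsin (1 / 3)"
    using arcsin_arccos_eq[of "- 1 / 3"] arcsin_minus[of "1 / 3"] by simp
  have half: "1.5 \<le> pi / 2" using pi_gt3 by simp
  have "1 / 3 < sin (0.33985 :: real)"
    using abs_le_D2[OF sin_Maclaurin_5[of "0.33985"]] by (simp add: power_divide)
  then have "arcsin (1 / 3) < arcsin (sin 0.33985)"
    by (intro arcsin_less_arcsin) auto
  then show "arccos (- 1 / 3) < pi / 2 + 0.33985"
    unfolding eq using half by (simp add: arcsin_sin)
  have "sin (0.3397 :: real) < 1 / 3"
    using abs_le_D1[OF sin_Maclaurin_5[of "0.3397"]] by (simp add: power_divide)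
  then have "arcsin (sin 0.3397) < arcsin (1 / 3)"
    by (intro arcsin_less_arcsin) auto
  then show "pi / 2 + 0.3397 < arccos (- 1 / 3)"
    unfolding eq using half by (simp add: arcsin_sin)
qed

text \<open>The value is 0.669265..., so the lower end 0.66925 is the tight one and dictates the
  accuracy of the constants; 2 / pi is only about 0.6366.\<close>

lemma absorb_prob_value_bounds:
  defines "P \<equiv> (5 * sqrt 2 - 3 / 2 * arccos (- 1 / 3)) / (2 * pi)"
  shows "\<bar>P - 0.6693\<bar> \<le> 5 / 10 ^ 5" "P > 2 / pi"
proof -
  have s: "1.41421 \<le> sqrt 2" "sqrt 2 \<le> 1.41422"
    by (rule real_le_rsqrt, simp add: power2_eq_square) (rule real_le_lsqrt, simp_all add: power2_eq_square)
  have lo: "0.66925 \<le> P"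
    using s arccos_minus_third_bounds pi_approx by (simp add: P_def field_simps)
  have hi: "P \<le> 0.66935"
    using s arccos_minus_third_bounds pi_approx by (simp add: P_def field_simps)
  show "\<bar>P - 0.6693\<bar> \<le> 5 / 10 ^ 5" by (rule abs_leI) (use lo hi in simp_all)
  have "2 / pi < 0.66925" using pi_approx by (simp add: field_simps)
  then show "P > 2 / pi" using lo by simp
qed

section \<open>The walk on the half line\<close>

lemma ell2_norm_proj_yes: "ell2_norm (proj_yes n \<psi>) = norm (\<psi> n)"
proof -
  have "(\<Sum>\<^sub>\<infinity>m. (norm (proj_yes n \<psi> m))\<^sup>2) = (\<Sum>\<^sub>\<infinity>m\<in>{n}. (norm (\<psi> m))\<^sup>2)"
    by (rule infsum_cong_neutral) (auto simp: proj_yes_def)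
  then show ?thesis by (simp add: ell2_norm_def)
qed

lemma evolve_nth:
  "evolve \<psi> m $ L = (2 * (\<psi> (m + 1) $ S + \<psi> (m + 1) $ R) - \<psi> (m + 1) $ L) / 3"
  "evolve \<psi> m $ S = (2 * (\<psi> m $ L + \<psi> m $ R) - \<psi> m $ S) / 3"
  "evolve \<psi> m $ R = (2 * (\<psi> (m - 1) $ L + \<psi> (m - 1) $ S) - \<psi> (m - 1) $ R) / 3"
  by (simp_all add: evolve_def shift_def coin_op_def grover_matrix_def matrix_vector_mult_def
      sum_coin field_simps)

text \<open>Multiplication by \<open>fps_X\<close> is one time step and the 3 is the denominator of
  the Grover matrix, so an identity of series becomes a recursion in time.\<close>

lemma fps_nth_Suc_of_eq_X_mult:
  fixes P Q :: "complex fps"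
  assumes "3 * P = fps_X * Q"
  shows "fps_nth P (Suc t) = fps_nth Q t / 3"
proof -
  have "fps_nth (3 * P) (Suc t) = fps_nth (fps_X * Q) (Suc t)" using assms by simp
  then show ?thesis by (simp add: numeral_fps_const field_simps)
qed

lemma fps_nth_coin_comb:
  fixes A B C D :: "complex fps"
  shows "fps_nth ((2 * (A + B) - C) * D) t = 2 * (fps_nth (A * D) t + fps_nth (B * D) t) - fps_nth (C * D) t"
proof -
  have "(2 * (A + B) - C) * D = fps_const 2 * (A * D + B * D) - C * D"
    by (simp add: algebra_simps flip: numeral_fps_const)
  then show ?thesis by simp
qed

definition survive :: "nat \<Rightarrow> state" where
  "survive t = ((\<lambda>\<phi>. proj_no (-1) (evolve \<phi>)) ^^ t) (initial_state 0 0 1)"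

text \<open>On the half line $m \ge 0$ the generating function of the surviving amplitudes is a bulk solution
  $v \lambda^m$ of the eigenvalue equation. Normalising $v_R = 1$ makes it absorb the source at
  $|0,R\rangle$, because nothing flows in from the site $-1$; the amplitude flowing out into $-1$
  is then $v_L / \lambda = F$.\<close>

locale absorption_fps =
  fixes F :: "complex fps"
  assumes quadratic: "2 * fps_X * F\<^sup>2 - (3 * fps_X\<^sup>2 - 2 * fps_X + 3) * F + 2 * fps_X = 0"
begin

text \<open>The ratio lambda of the profile. With s the sum of the three components of v, the bulk
  equations read F + X v_L = (1 + X) v_S = lambda + X = 2/3 X s. Putting v_L = F lambda into the
  outer equality and solving gives this formula; the middle one then gives v_S.\<close>

definition decay :: "complex fps" where
  "decay = (F - fps_X) * inverse (1 - fps_X * F)"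

definition amp :: "coin \<Rightarrow> complex fps" where
  "amp c = (case c of L \<Rightarrow> F * decay | S \<Rightarrow> F * (1 - fps_X) * inverse (1 - fps_X * F) | R \<Rightarrow> 1)"

lemma F_0: "fps_nth F 0 = 0"
  using arg_cong[OF quadratic, of "\<lambda>P. fps_nth P 0"] by (simp add: power2_eq_square)

lemma decay_0: "fps_nth decay 0 = 0"
  by (simp add: decay_def F_0)

text \<open>One relation per row of the Grover matrix. The L row has \<open>F\<close> on the left
  because the inflow comes from site m + 1, and dividing by one more power of lambda turns v_L into
  v_L / lambda. Once lambda and v are expressed through F, the remaining condition is
  \<open>quadratic\<close>.\<close>

lemma bulk_equations:
  "3 * F = fps_X * (2 * (amp S + amp R) - amp L)"
  "3 * amp S = fps_X * (2 * (amp L + amp R) - amp S)"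
  "3 * decay = fps_X * (2 * (amp L + amp S) - amp R)"
proof -
  define X :: "complex fps" where "X = fps_X"
  define J where "J = inverse (1 - X * F)"
  have J: "J * (1 - X * F) = 1"
    unfolding J_def by (rule inverse_mult_eq_1) (simp add: X_def)
  have q: "2 * X * F\<^sup>2 - (3 * X\<^sup>2 - 2 * X + 3) * F + 2 * X = 0"
    using quadratic by (simp add: X_def)
  note defs = amp_def decay_def coin.case X_def[symmetric] J_def[symmetric]
  show "3 * F = fps_X * (2 * (amp S + amp R) - amp L)"
    unfolding defs using J q by algebra
  show "3 * amp S = fps_X * (2 * (amp L + amp R) - amp S)"
    unfolding defs using J q by algebra
  show "3 * decay = fps_X * (2 * (amp L + amp S) - amp R)"
    unfolding defs using J q by algebra
qed

text \<open>Both sides agree at time 0, where only |0,R> is occupied because \<open>F\<close> and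
  \<open>decay\<close> have no constant term, and both obey the same recursion in time.\<close>

lemma survive_nth:
  "survive t m $ c = (if m < 0 then 0 else fps_nth (amp c * decay ^ nat m) t)"
proof (induction t arbitrary: m c)
  case 0
  show ?case
    by (cases c)
      (auto simp: survive_def initial_state_def ket_def axis_def amp_def F_0 decay_0 fps_power_zeroth)
next
  case (Suc t)
  have step: "survive (Suc t) k = (if k = - 1 then 0 else evolve (survive t) k)" for k
    by (simp add: survive_def proj_no_def proj_yes_def)
  show ?case
  proof (cases "m < 0")
    case True
    then show ?thesis by (cases c) (auto simp: step evolve_nth Suc.IH)
  next
    case False
    then obtain n where m: "m = int n" by (metis nonneg_int_cases not_less)
    have n1: "nat (int k + 1) = Suc k" "nat (1 + int k) = Suc k" for k by simp_all
    have eL: "3 * (amp L * decay ^ n) = fps_X * ((2 * (amp S + amp R) - amp L) * decay ^ Suc n)"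
    proof -
      have "3 * (amp L * decay ^ n) = 3 * F * decay ^ Suc n" by (simp add: amp_def mult_ac)
      then show ?thesis by (simp only: bulk_equations(1) mult.assoc)
    qed
    have eS: "3 * (amp S * decay ^ n) = fps_X * ((2 * (amp L + amp R) - amp S) * decay ^ n)"
    proof -
      have "3 * (amp S * decay ^ n) = 3 * amp S * decay ^ n" by (simp only: mult.assoc)
      then show ?thesis by (simp only: bulk_equations(2) mult.assoc)
    qed
    have eR: "3 * (amp R * decay ^ Suc k) = fps_X * ((2 * (amp L + amp S) - amp R) * decay ^ k)" for k
    proof -
      have "3 * (amp R * decay ^ Suc k) = 3 * decay * decay ^ k" by (simp add: amp_def mult_ac)
      then show ?thesis by (simp only: bulk_equations(3) mult.assoc)
    qed
    show ?thesis
    proof (cases c)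
      case L
      then show ?thesis
        using fps_nth_Suc_of_eq_X_mult[OF eL, of t] unfolding fps_nth_coin_comb
        by (simp add: step evolve_nth Suc.IH m n1)
    next
      case S
      then show ?thesis
        using fps_nth_Suc_of_eq_X_mult[OF eS, of t] unfolding fps_nth_coin_comb
        by (simp add: step evolve_nth Suc.IH m)
    next
      case R
      show ?thesis
      proof (cases n)
        case 0
        \<comment> \<open>The R component at site 0 would be fed from the empty site -1, so it
          vanishes after time 0, just like the later coefficients of \<open>amp R\<close> =
          1.\<close>
        then show ?thesis by (simp add: R step evolve_nth Suc.IH m amp_def)
      next
        case (Suc k)
        then show ?thesis
          using fps_nth_Suc_of_eq_X_mult[OF eR, of k t] unfolding fps_nth_coin_comb
          by (simp add: R step evolve_nth Suc.IH m n1)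
      qed
    qed
  qed
qed

text \<open>Only the L component can enter -1 from site 0; S and R would come from the empty sites
  -1 and -2. The state after t steps is absorbed at step t + 1, hence the shifted index.\<close>

lemma norm_absorbed: "norm (evolve (survive t) (- 1)) = cmod (fps_nth F (Suc t))"
proof -
  have "evolve (survive t) (- 1) $ L = fps_nth F (Suc t)"
    using fps_nth_Suc_of_eq_X_mult[OF bulk_equations(1), of t]
    by (simp add: evolve_nth survive_nth numeral_fps_const)
  moreover have "evolve (survive t) (- 1) $ S = 0" "evolve (survive t) (- 1) $ R = 0"
    by (simp_all add: evolve_nth survive_nth)
  ultimately have "(norm (evolve (survive t) (- 1)))\<^sup>2 = (cmod (fps_nth F (Suc t)))\<^sup>2"
    by (simp add: norm_coin_sq)
  then show ?thesis by simp
qed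

lemma absorb_prob_eq:
  assumes "(\<lambda>n. (cmod (fps_nth F n))\<^sup>2) sums P"
  shows "absorb_prob 0 0 1 = P"
proof -
  have "absorb_prob 0 0 1 = (\<Sum>\<^sub>\<infinity>t\<in>{1..}. (cmod (fps_nth F t))\<^sup>2)"
    unfolding absorb_prob_def
  proof (rule infsum_cong)
    fix t :: nat assume "t \<in> {1..}"
    then show "(ell2_norm (proj_yes (-1) (evolve
        (((\<lambda>\<phi>. proj_no (-1) (evolve \<phi>)) ^^ (t - 1)) (initial_state 0 0 1)))))\<^sup>2 = (cmod (fps_nth F t))\<^sup>2"
      using norm_absorbed[of "t - 1"] by (simp add: ell2_norm_proj_yes flip: survive_def)
  qed
  \<comment> \<open>The index 0 may be added because \<open>F\<close> has no constant term.\<close>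
  also have "\<dots> = (\<Sum>\<^sub>\<infinity>t. (cmod (fps_nth F t))\<^sup>2)"
    by (rule infsum_cong_neutral) (auto simp: F_0 not_le)
  also have "\<dots> = P"
    using sums_nonneg_imp_has_sum[OF assms] by (intro infsumI) simp
  finally show ?thesis .
qed

end

section \<open>The absorbing probability\<close>

text \<open>The quadratic holds pointwise, so its left side expands both to the zero series and to
  the quadratic in the expansion of \<open>absorb_gf\<close>; uniqueness of expansions identifies
  them.\<close>

lemma absorption_fps_absorb_gf: "absorption_fps (fps_expansion absorb_gf 0)"
proof
  let ?F = "fps_expansion absorb_gf 0"
  have F: "absorb_gf has_fps_expansion ?F"
    using holomorphic_on_absorb_gf by (intro has_fps_expansion_fps_expansion[of "ball 0 1"]) auto
  have "(\<lambda>z. 2 * z * (absorb_gf z)\<^sup>2 - (3 * z\<^sup>2 - 2 * z + 3) * absorb_gf z + 2 * z) has_fps_expansion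
      2 * fps_X * ?F\<^sup>2 - (3 * fps_X\<^sup>2 - 2 * fps_X + 3) * ?F + 2 * fps_X"
    by (intro fps_expansion_intros F)
  moreover have "(\<lambda>z :: complex. 0 :: complex) has_fps_expansion 0" by (rule has_fps_expansion_0)
  ultimately show "2 * fps_X * ?F\<^sup>2 - (3 * fps_X\<^sup>2 - 2 * fps_X + 3) * ?F + 2 * fps_X = 0"
    unfolding absorb_gf_quadratic by (rule fps_expansion_unique_complex)
qed

lemma absorb_prob_closed_form:
  "absorb_prob 0 0 1 = (5 * sqrt 2 - 3 / 2 * arccos (- 1 / 3)) / (2 * pi)"
proof -
  let ?F = "fps_expansion absorb_gf 0"
  have holo: "absorb_gf holomorphic_on eball 0 1"
    using holomorphic_on_absorb_gf by (simp add: one_ereal_def)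
  have "eval_fps ?F z = absorb_gf z" if "cmod z < 1" for z
    using eval_fps_expansion'[OF holo, of z] that by simp
  then have "(\<lambda>n. (cmod (fps_nth ?F n))\<^sup>2) sums
      (integral {0..2 * pi} (\<lambda>t. (cmod (absorb_gf (cis t)))\<^sup>2) / (2 * pi))"
    by (intro parseval_closed_disc conv_radius_fps_expansion holo continuous_on_absorb_gf)
  moreover have "integral {0..2 * pi} (\<lambda>t. (cmod (absorb_gf (cis t)))\<^sup>2) =
      5 * sqrt 2 - 3 / 2 * arccos (- 1 / 3)"
    unfolding norm_absorb_gf_cis by (rule integral_unique[OF has_integral_boundary_modulus])
  ultimately show ?thesis
    using absorption_fps.absorb_prob_eq[OF absorption_fps_absorb_gf] by simp
qed

theorem mainTheorem3:
  shows "\<bar>absorb_prob 0 0 1 - 0.6693\<bar> \<le> 5 / 10 ^ 5 \<and> absorb_prob 0 0 1 > 2 / pi"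
  unfolding absorb_prob_closed_form using absorb_prob_value_bounds by blast

end
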